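(* Let $\mathsf{A}\in\mathbb{R}^{J_1\times J_1\times\cdots\times J_N\times J_N}$ and $\mathsf{B}\in\mathbb{R}^{J_1\times K_1\times\cdots\times J_N\times K_N}$, and let $$\mathscr{R}=\begin{vmatrix}\mathsf{B}&\mathsf{A}*\mathsf{B}&\cdots&\mathsf{A}^{\Pi_{\mathcal{J}}-1}*\mathsf{B}\end{vmatrix}\in\mathbb{R}^{J_1\times J_1K_1\times\cdots\times J_N\times J_NK_N}$$ be the reachability tensor, where $\Pi_{\mathcal{J}}=\prod_{n=1}^NJ_n$. Let $\tilde{\mathscr{R}}\in\mathbb{R}^{J_1\times\cdots\times J_N\times J_1K_1\times\cdots\times J_NK_N}$ be given by $\tilde{\mathscr{R}}_{j_1\cdots j_Nl_1\cdots l_N}=\mathscr{R}_{j_1l_1\cdots j_Nl_N}$. Then the pair $(\mathsf{A},\mathsf{B})$ is reachable if and only if the $N$-th optimal TT-rank of $\tilde{\mathscr{R}}$ is equal to $\Pi_{\mathcal{J}}$.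
   Context: Einstein products: $(\mathsf{A}*\mathsf{X})_{j_1\cdots j_N}=\sum_{i_1,\dots,i_N}\mathsf{A}_{j_1i_1\cdots j_Ni_N}\mathsf{X}_{i_1\cdots i_N}$ for an $N$-th order $\mathsf{X}$, and $(\mathsf{A}*\mathsf{B})_{j_1i_1\cdots j_Ni_N}=\sum_{k_1,\dots,k_N}\mathsf{A}_{j_1k_1\cdots j_Nk_N}\mathsf{B}_{k_1i_1\cdots k_Ni_N}$ for even-order paired tensors; $\mathsf{A}^k$ is the $k$-fold Einstein product, $\mathsf{A}^0$ being the identity tensor for $*$. The pair $(\mathsf{A},\mathsf{B})$ is reachable on $[t_0,t_1]$ ($t_0<t_1$ integers) if for any $\mathsf{X}_0,\mathsf{X}_1\in\mathbb{R}^{J_1\times\cdots\times J_N}$ there are inputs $\mathsf{U}_t\in\mathbb{R}^{K_1\times\cdots\times K_N}$, $t_0\le t\le t_1-1$, steering $\mathsf{X}_{t+1}=\mathsf{A}*\mathsf{X}_t+\mathsf{B}*\mathsf{U}_t$ from $\mathsf{X}_{t_0}=\mathsf{X}_0$ to $\mathsf{X}_{t_1}=\mathsf{X}_1$. The pair is reachable if it is reachable on some interval $[t_0,t_1]$. Mode row block tensor: given $P=P_1\cdots P_N$ tensors $\mathsf{Z}_1,\dots,\mathsf{Z}_P\in\mathbb{R}^{J_1\times K_1\times\cdots\times J_N\times K_N}$, the tensor $\begin{vmatrix}\mathsf{Z}_1&\cdots&\mathsf{Z}_P\end{vmatrix}\in\mathbb{R}^{J_1\times K_1P_1\times\cdots\times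 J_N\times K_NP_N}$ is obtained by concatenating consecutive groups of $P_1$ tensors along the second index of the first pair, then consecutive groups of $P_2$ of the results along the second index of the second pair, and so on; explicitly its entry at $(j_1,l_1,\dots,j_N,l_N)$ with $l_n=(p_n-1)K_n+k_n$, $1\le k_n\le K_n$, $1\le p_n\le P_n$, is $(\mathsf{Z}_p)_{j_1k_1\cdots j_Nk_N}$ with $p=p_1+\sum_{n=2}^N(p_n-1)\prod_{l=1}^{n-1}P_l$. For $\mathscr{R}$ one takes $P_n=J_n$ and $\mathsf{Z}_p=\mathsf{A}^{p-1}*\mathsf{B}$. The $n$-th optimal TT-rank of $\mathsf{Y}\in\mathbb{R}^{L_1\times\cdots\times L_M}$ ($1\le n\le M-1$) is the rank of the matrix $\texttt{reshape}(\mathsf{Y},\prod_{i\le n}L_i,\prod_{i>n}L_i)$, with rows indexed by $(l_1,\dots,l_n)$ and columns by $(l_{n+1},\dots,l_M)$. *)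

theory Defs
  imports "Jordan_Normal_Form.DL_Rank"
begin

(* A tensor of size L_1 x ... x L_M is an extensional function on its multi-indices, which are
   lists of length M. Indices are 0-based: 0 <= l_n < L_n. *)

type_synonym tensor = "nat list \<Rightarrow> real"

definition multi_indices :: "nat list \<Rightarrow> nat list set" where
  "multi_indices Ls = {ls. length ls = length Ls \<and> (\<forall>n < length Ls. ls ! n < Ls ! n)}"

definition tensors :: "nat list \<Rightarrow> tensor set" where
  "tensors Ls = (multi_indices Ls \<rightarrow>\<^sub>E UNIV)"

definition tensor_add :: "nat list \<Rightarrow> tensor \<Rightarrow> tensor \<Rightarrow> tensor" where
  "tensor_add Ls X Y = (\<lambda>ls \<in> multi_indices Ls. X ls + Y ls)"

(* Even-order paired tensors of size J_1 x I_1 x ... x J_N x I_N are the tensors of size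
   splice Js Is, since splice [j1, ..., jN] [i1, ..., iN] = [j1, i1, ..., jN, iN]. The following
   two functions recover the two halves. *)

definition fst_modes :: "nat list \<Rightarrow> nat list" where
  "fst_modes ms = map (\<lambda>n. ms ! (2 * n)) [0..<length ms div 2]"

definition snd_modes :: "nat list \<Rightarrow> nat list" where
  "snd_modes ms = map (\<lambda>n. ms ! (2 * n + 1)) [0..<length ms div 2]"

lemma modes_splice:
  assumes "length js = length is'"
  shows "fst_modes (splice js is') = js" "snd_modes (splice js is') = is'"
    and "length (splice js is') = 2 * length js"
proof -
  have nth: "n < length js \<longrightarrow>
      splice js is' ! (2 * n) = js ! n \<and> splice js is' ! (Suc (2 * n)) = is' ! n" for n
    using assms
  proof (induction js is' arbitrary: n rule: list_induct2)
    case (Cons x xs y ys)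
    then show ?case by (cases n) auto
  qed simp
  show len: "length (splice js is') = 2 * length js"
    using assms by simp
  show "fst_modes (splice js is') = js"
    by (rule nth_equalityI) (use len nth in \<open>auto simp: fst_modes_def\<close>)
  show "snd_modes (splice js is') = is'"
    by (rule nth_equalityI) (use len nth assms in \<open>auto simp: snd_modes_def\<close>)
qed

(* A of size splice Js Is applied to X of size Is *)
definition einstein_apply :: "nat list \<Rightarrow> nat list \<Rightarrow> tensor \<Rightarrow> tensor \<Rightarrow> tensor" where
  "einstein_apply Js Is A X =
     (\<lambda>js \<in> multi_indices Js. \<Sum>is' \<in> multi_indices Is. A (splice js is') * X is')"

(* A of size splice Js Ks times B of size splice Ks Is *)
definition einstein_prod ::
  "nat list \<Rightarrow> nat list \<Rightarrow> nat list \<Rightarrow> tensor \<Rightarrow> tensor \<Rightarrow> tensor" where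
  "einstein_prod Js Ks Is A B =
     (\<lambda>ms \<in> multi_indices (splice Js Is).
        \<Sum>ks \<in> multi_indices Ks. A (splice (fst_modes ms) ks) * B (splice ks (snd_modes ms)))"

definition einstein_id :: "nat list \<Rightarrow> tensor" where
  "einstein_id Js =
     (\<lambda>ms \<in> multi_indices (splice Js Js). if fst_modes ms = snd_modes ms then 1 else 0)"

primrec einstein_pow :: "nat list \<Rightarrow> tensor \<Rightarrow> nat \<Rightarrow> tensor" where
  "einstein_pow Js A 0 = einstein_id Js"
| "einstein_pow Js A (Suc k) = einstein_prod Js Js Js A (einstein_pow Js A k)"

definition reachable_on ::
  "nat list \<Rightarrow> nat list \<Rightarrow> tensor \<Rightarrow> tensor \<Rightarrow> int \<Rightarrow> int \<Rightarrow> bool" where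
  "reachable_on Js Ks A B t0 t1 \<longleftrightarrow>
     (\<forall>X0 \<in> tensors Js. \<forall>X1 \<in> tensors Js.
        \<exists>U X :: int \<Rightarrow> tensor.
          (\<forall>t \<in> {t0..t1 - 1}. U t \<in> tensors Ks) \<and>
          (\<forall>t \<in> {t0..t1}. X t \<in> tensors Js) \<and>
          (\<forall>t \<in> {t0..t1 - 1}.
             X (t + 1) = tensor_add Js (einstein_apply Js Js A (X t)) (einstein_apply Js Ks B (U t))) \<and>
          X t0 = X0 \<and> X t1 = X1)"

definition reachable :: "nat list \<Rightarrow> nat list \<Rightarrow> tensor \<Rightarrow> tensor \<Rightarrow> bool" where
  "reachable Js Ks A B \<longleftrightarrow> (\<exists>t0 t1. t0 < t1 \<and> reachable_on Js Ks A B t0 t1)"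

(* Linearisation with the first index running fastest; in 1-based terms,
   l = l_1 + sum_{n >= 2} (l_n - 1) * prod_{k < n} L_k. *)
definition lin_index :: "nat list \<Rightarrow> nat list \<Rightarrow> nat" where
  "lin_index Ls ls = (\<Sum>n < length Ls. ls ! n * (\<Prod>k < n. Ls ! k))"

definition multi_index :: "nat list \<Rightarrow> nat \<Rightarrow> nat list" where
  "multi_index Ls = the_inv_into (multi_indices Ls) (lin_index Ls)"

lemma lin_index_Nil [simp]: "lin_index [] ls = 0"
  by (simp add: lin_index_def)

lemma lin_index_Cons [simp]: "lin_index (L # Ls) (l # ls) = l + L * lin_index Ls ls"
  by (simp add: lin_index_def sum.lessThan_Suc_shift prod.lessThan_Suc_shift sum_distrib_left
      ac_simps del: sum.lessThan_Suc prod.lessThan_Suc)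

lemma multi_indices_Nil [simp]: "multi_indices [] = {[]}"
  by (auto simp: multi_indices_def)

lemma multi_indices_Cons:
  "multi_indices (L # Ls) = (\<lambda>(l, ls). l # ls) ` ({..<L} \<times> multi_indices Ls)"
proof (intro equalityI subsetI)
  fix ms assume m: "ms \<in> multi_indices (L # Ls)"
  then obtain l ls where "ms = l # ls"
    by (cases ms) (auto simp: multi_indices_def)
  with m show "ms \<in> (\<lambda>(l, ls). l # ls) ` ({..<L} \<times> multi_indices Ls)"
    by (force simp: multi_indices_def)
qed (auto simp: multi_indices_def nth_Cons split: nat.split)

lemma bij_betw_lin_index: "bij_betw (lin_index Ls) (multi_indices Ls) {..<prod_list Ls}"
proof (induction Ls)
  case Nil
  then show ?case by (auto simp: bij_betw_def)
next
  case (Cons L Ls)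
  have inj: "inj_on (lin_index (L # Ls)) (multi_indices (L # Ls))"
  proof (rule inj_onI)
    fix x y assume "x \<in> multi_indices (L # Ls)" "y \<in> multi_indices (L # Ls)"
      and eq: "lin_index (L # Ls) x = lin_index (L # Ls) y"
    then obtain a as b bs where xy: "x = a # as" "y = b # bs" "a < L" "b < L"
      "as \<in> multi_indices Ls" "bs \<in> multi_indices Ls"
      by (auto simp: multi_indices_Cons)
    have e: "a + L * lin_index Ls as = b + L * lin_index Ls bs"
      using eq xy by simp
    have "a = b" using arg_cong[OF e, of "\<lambda>z. z mod L"] xy by simp
    moreover have "lin_index Ls as = lin_index Ls bs"
      using e xy \<open>a = b\<close> by simp
    ultimately show "x = y"
      using Cons.IH xy by (auto simp: bij_betw_def dest: inj_onD)
  qed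
  have "lin_index (L # Ls) ` multi_indices (L # Ls) = {..<prod_list (L # Ls)}"
  proof (intro equalityI subsetI)
    fix z assume "z \<in> lin_index (L # Ls) ` multi_indices (L # Ls)"
    then obtain a as where z: "z = a + L * lin_index Ls as" "a < L" "as \<in> multi_indices Ls"
      by (auto simp: multi_indices_Cons)
    then have "lin_index Ls as < prod_list Ls"
      using Cons.IH by (auto simp: bij_betw_def)
    then have "L * (lin_index Ls as + 1) \<le> L * prod_list Ls"
      by (intro mult_le_mono2) simp
    then show "z \<in> {..<prod_list (L # Ls)}" using z by simp
  next
    fix z assume z: "z \<in> {..<prod_list (L # Ls)}"
    then have L: "L > 0" by (cases "L = 0") auto
    have "z div L < prod_list Ls"
      using z L by (simp add: less_mult_imp_div_less mult.commute)
    then obtain as where "as \<in> multi_indices Ls" "lin_index Ls as = z div L"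
      using Cons.IH unfolding bij_betw_def by (metis imageE lessThan_iff)
    then have "z mod L # as \<in> multi_indices (L # Ls)" "lin_index (L # Ls) (z mod L # as) = z"
      using L by (auto simp: multi_indices_Cons)
    then show "z \<in> lin_index (L # Ls) ` multi_indices (L # Ls)" by (metis imageI)
  qed
  with inj show ?case by (simp add: bij_betw_def)
qed

(* Zs lists P_1 * ... * P_N tensors of size splice Js Ks. The 0-based index l_n of the n-th second
   mode (of extent K_n * P_n) is p_n * K_n + k_n, so p_n = l_n div K_n and k_n = l_n mod K_n. *)
definition mode_row_block ::
  "nat list \<Rightarrow> nat list \<Rightarrow> nat list \<Rightarrow> tensor list \<Rightarrow> tensor" where
  "mode_row_block Js Ks Ps Zs =
     (\<lambda>ms \<in> multi_indices (splice Js (map2 (*) Ks Ps)).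
        (Zs ! lin_index Ps (map2 (div) (snd_modes ms) Ks))
          (splice (fst_modes ms) (map2 (mod) (snd_modes ms) Ks)))"

definition reachability_tensor :: "nat list \<Rightarrow> nat list \<Rightarrow> tensor \<Rightarrow> tensor \<Rightarrow> tensor" where
  "reachability_tensor Js Ks A B =
     mode_row_block Js Ks Js
       (map (\<lambda>p. einstein_prod Js Js Ks (einstein_pow Js A p) B) [0..<prod_list Js])"

(* From size splice Js Is (entries Y_{j1 i1 ... jN iN}) to size Js @ Is
   (entries Y_{j1 ... jN i1 ... iN}) *)
definition unpair_modes :: "nat list \<Rightarrow> nat list \<Rightarrow> tensor \<Rightarrow> tensor" where
  "unpair_modes Js Is Y =
     (\<lambda>ms \<in> multi_indices (Js @ Is).
        Y (splice (take (length Js) ms) (drop (length Js) ms)))"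

definition unfolding_mat :: "nat list \<Rightarrow> nat \<Rightarrow> tensor \<Rightarrow> real mat" where
  "unfolding_mat Ls n Y =
     mat (prod_list (take n Ls)) (prod_list (drop n Ls))
       (\<lambda>(r, c). Y (multi_index (take n Ls) r @ multi_index (drop n Ls) c))"

(* The n-th optimal TT-rank of Y of size Ls, meant for 1 <= n < length Ls *)
definition optimal_tt_rank :: "nat list \<Rightarrow> nat \<Rightarrow> tensor \<Rightarrow> nat" where
  "optimal_tt_rank Ls n Y =
     vec_space.rank (dim_row (unfolding_mat Ls n Y)) (unfolding_mat Ls n Y)"

end

(* After T steps the state is the free response A^T * X_0 plus sum_{p < T} A^p * B * U_{T-1-p}, so
   reachability in T steps says that the tensors A^p * B with p < T jointly span the state space.
   As the state space has dimension Pi_J, the sequence A^p * B * U satisfies a linear dependency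
   among its first Pi_J + 1 terms, which A propagates to all later ones; hence T = Pi_J steps suffice
   whenever any T does (no Cayley-Hamilton needed). The columns of the unfolding of the reachability
   tensor are exactly the columns of the A^p * B with p < Pi_J, so full row rank says the same. *)
theory Submission
  imports Defs
begin

section \<open>Linear dependencies and linear recurrences\<close>

text \<open>Dimension count: the \<open>card I + 1\<close> vectors \<open>v 0\<close>, ...,
  \<open>v (card I)\<close> live in a space of dimension \<open>card I\<close>.\<close>

lemma exists_linear_dependency:
  fixes v :: "nat \<Rightarrow> 'i \<Rightarrow> 'a :: field"
  assumes "finite I"
  obtains c where "\<exists>i \<le> card I. c i \<noteq> 0" "\<And>j. j \<in> I \<Longrightarrow> (\<Sum>i\<le>card I. c i * v i j) = 0"
proof -
  define n where "n = card I"
  obtain e where e: "bij_betw e {..<n} I"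
    using ex_bij_betw_nat_finite[OF assms] by (auto simp: n_def atLeast0LessThan)
  \<comment> \<open>The vectors are the columns; a zero row at index \<open>n\<close> makes the
    matrix square. Laplace expansion along that row gives determinant 0, and a nonzero kernel vector
    holds the coefficients.\<close>
  define M where "M = mat (Suc n) (Suc n) (\<lambda>(r, q). if r < n then v q (e r) else 0)"
  have M: "M \<in> carrier_mat (Suc n) (Suc n)" by (simp add: M_def)
  have "det M = 0"
    unfolding laplace_expansion_row[OF M, of n, simplified] by (auto simp: M_def intro: sum.neutral)
  then obtain w where w: "w \<in> carrier_vec (Suc n)" "w \<noteq> 0\<^sub>v (Suc n)" "M *\<^sub>v w = 0\<^sub>v (Suc n)"
    using det_0_iff_vec_prod_zero[OF M] by blast
  show ?thesis
  proof
    show "\<exists>i \<le> card I. w $ i \<noteq> 0"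
      using w(1,2) by (auto simp: n_def less_Suc_eq_le)
    fix j assume "j \<in> I"
    then obtain r where r: "r < n" "j = e r"
      using e by (auto simp: bij_betw_def)
    have "(\<Sum>i<Suc n. w $ i * v i j) = (M *\<^sub>v w) $ r"
      using r w(1) by (auto simp: M_def scalar_prod_def atLeast0LessThan ac_simps)
    with w(3) r show "(\<Sum>i\<le>card I. w $ i * v i j) = 0"
      by (simp add: n_def lessThan_Suc_atMost del: sum.lessThan_Suc)
  qed
qed

text \<open>With \<open>a\<close> read as a matrix, \<open>v m\<close> is \<open>a\<close> applied
  \<open>m\<close> times to \<open>v 0\<close>. A dependency among the first
  \<open>card I + 1\<close> terms stays valid when all its indices are shifted, so every later term
  reduces to earlier ones.\<close>

lemma linear_recurrence_span:
  fixes v :: "nat \<Rightarrow> 'i \<Rightarrow> 'a :: field"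
  assumes fin: "finite I"
    and step: "\<And>m j. j \<in> I \<Longrightarrow> v (Suc m) j = (\<Sum>i\<in>I. a j i * v m i)"
  shows "\<exists>c. \<forall>j\<in>I. v m j = (\<Sum>i<card I. c i * v i j)"
proof -
  obtain c where c: "\<exists>i \<le> card I. c i \<noteq> 0"
    and dep: "\<And>j. j \<in> I \<Longrightarrow> (\<Sum>i\<le>card I. c i * v i j) = 0"
    using exists_linear_dependency[OF fin] by metis
  \<comment> \<open>The coefficient at \<open>card I\<close> may vanish, so the dependency is cut at
    its last nonzero coefficient, by which one can divide.\<close>
  define k where "k = Max {i. i \<le> card I \<and> c i \<noteq> 0}"
  have "k \<in> {i. i \<le> card I \<and> c i \<noteq> 0}"
    unfolding k_def by (rule Max_in) (use c in auto)
  then have k: "k \<le> card I" "c k \<noteq> 0" by auto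
  have zero: "c i = 0" if "k < i" "i \<le> card I" for i
  proof (rule ccontr)
    assume "c i \<noteq> 0"
    then have "i \<le> k" unfolding k_def using that by (intro Max_ge) auto
    with that show False by simp
  qed
  have trunc: "(\<Sum>i\<le>card I. c i * f i) = (\<Sum>i\<le>k. c i * f i)" for f
    by (rule sum.mono_neutral_right) (use k zero in \<open>auto simp: not_le\<close>)
  \<comment> \<open>Applying \<open>a\<close> to the dependency raises every index by one.\<close>
  have shift: "(\<Sum>i\<le>k. c i * v (i + s) j) = 0" if "j \<in> I" for s j
    using that
  proof (induction s arbitrary: j)
    case 0
    then show ?case using dep trunc by simp
  next
    case (Suc s)
    have "(\<Sum>i\<le>k. c i * v (i + Suc s) j) = (\<Sum>i\<le>k. \<Sum>l\<in>I. a j l * (c i * v (i + s) l))"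
      using Suc.prems by (simp add: step sum_distrib_left ac_simps)
    also have "\<dots> = (\<Sum>l\<in>I. a j l * (\<Sum>i\<le>k. c i * v (i + s) l))"
      by (subst sum.swap) (simp add: sum_distrib_left)
    also have "\<dots> = 0" using Suc.IH by simp
    finally show ?case .
  qed
  show ?thesis
  proof (induction m rule: less_induct)
    case (less m)
    show ?case
    proof (cases "m < card I")
      case True
      then show ?thesis
        by (intro exI[of _ "\<lambda>i. if i = m then 1 else 0"]) (simp add: if_distrib[of "\<lambda>x. x * _"] cong: if_cong)
    next
      case False
      \<comment> \<open>Shifting by \<open>s\<close> makes \<open>v m\<close> the top term of the
        dependency. This is possible because \<open>k \<le> card I \<le> m\<close>; the other terms
        have indices \<open>i + s < m\<close> and fall under the induction hypothesis.\<close>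
      define s where "s = m - k"
      have m: "m = k + s" using False k by (simp add: s_def)
      have "\<forall>i<k. \<exists>d. \<forall>j\<in>I. v (i + s) j = (\<Sum>l<card I. d l * v l j)"
        using less.IH m by simp
      then obtain d where d: "\<And>i j. i < k \<Longrightarrow> j \<in> I \<Longrightarrow> v (i + s) j = (\<Sum>l<card I. d i l * v l j)"
        by metis
      have "v m j = (\<Sum>l<card I. (\<Sum>i<k. - c i / c k * d i l) * v l j)" if "j \<in> I" for j
      proof -
        have "c k * v m j = - (\<Sum>i<k. c i * v (i + s) j)"
          using shift[OF that, of s] unfolding m by (simp flip: lessThan_Suc_atMost add: eq_neg_iff_add_eq_0 add.commute)
        then have "v m j = (\<Sum>i<k. - c i / c k * v (i + s) j)"
          using k(2) by (simp add: field_simps sum_negf flip: sum_divide_distrib)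
        also have "\<dots> = (\<Sum>i<k. \<Sum>l<card I. - c i / c k * d i l * v l j)"
          using that by (simp add: d sum_distrib_left mult.assoc)
        also have "\<dots> = (\<Sum>l<card I. (\<Sum>i<k. - c i / c k * d i l) * v l j)"
          by (subst sum.swap) (simp add: sum_distrib_right)
        finally show ?thesis .
      qed
      then show ?thesis by (intro exI[of _ "\<lambda>l. \<Sum>i<k. - c i / c k * d i l"] ballI)
    qed
  qed
qed

section \<open>Full row rank as surjectivity\<close>

text \<open>The products \<open>A *\<^sub>v x\<close> fill the column space, and
  \<open>rank A\<close> is its dimension; a subspace of dimension \<open>n\<close> in an
  \<open>n\<close>-dimensional space is everything.\<close>

lemma (in vec_space) rank_eq_n_iff_surj:
  assumes A: "A \<in> carrier_mat n nc"
  shows "rank A = n \<longleftrightarrow> (\<forall>y \<in> carrier_vec n. \<exists>x \<in> carrier_vec nc. A *\<^sub>v x = y)"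
proof -
  have cols: "set (cols A) \<subseteq> carrier_vec n" using cols_dim A by blast
  have surj: "span (set (cols A)) = carrier_vec n \<longleftrightarrow>
      (\<forall>y \<in> carrier_vec n. \<exists>x \<in> carrier_vec nc. A *\<^sub>v x = y)"
    using col_space_eq[OF A] A unfolding col_space_def by auto
  have "rank A = n \<longleftrightarrow> span (set (cols A)) = carrier_vec n"
  proof
    assume r: "rank A = n"
    \<comment> \<open>A maximal independent set of columns has \<open>rank A\<close> elements; when
      there are \<open>n\<close> of them they form a basis of the whole space.\<close>
    obtain S where S: "finite S" "maximal S (\<lambda>T. T \<subseteq> set (cols A) \<and> lin_indpt T)"
      using maximal_exists_superset[of "set (cols A)" "\<lambda>T. T \<subseteq> set (cols A) \<and> lin_indpt T" "{}"]
        finite_lin_indpt2[of "{}"] by auto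
    then have sub: "S \<subseteq> set (cols A)" and li: "lin_indpt S" by (auto simp: maximal_def)
    have "card S = n" using rank_card_indpt[OF A S(2)] r by simp
    then have "basis S"
      using dim_li_is_basis[of S] S(1) sub cols li dim_is_n by auto
    then have "span S = carrier_vec n" by (simp add: basis_def)
    moreover have "span S \<subseteq> span (set (cols A))" using sub by (rule span_is_monotone)
    ultimately show "span (set (cols A)) = carrier_vec n"
      using span_is_subset2[of "set (cols A)"] cols by auto
  next
    assume "span (set (cols A)) = carrier_vec n"
    then show "rank A = n" unfolding rank_def using dim_is_n by (simp add: module_vec_def)
  qed
  with surj show ?thesis by simp
qed

section \<open>Multi-indices\<close>

lemma finite_multi_indices: "finite (multi_indices Ls)"
  and card_multi_indices: "card (multi_indices Ls) = prod_list Ls"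
  using bij_betw_finite[OF bij_betw_lin_index[of Ls]] bij_betw_same_card[OF bij_betw_lin_index[of Ls]]
  by auto

lemma bij_betw_multi_index: "bij_betw (multi_index Ls) {..<prod_list Ls} (multi_indices Ls)"
  unfolding multi_index_def by (rule bij_betw_the_inv_into) (rule bij_betw_lin_index)

lemma length_multi_indices: "ls \<in> multi_indices Ls \<Longrightarrow> length ls = length Ls"
  by (simp add: multi_indices_def)

lemma Cons_in_multi_indices_iff:
  "l # ls \<in> multi_indices (L # Ls) \<longleftrightarrow> l < L \<and> ls \<in> multi_indices Ls"
  by (auto simp: multi_indices_Cons)

lemma splice_in_multi_indices:
  assumes "js \<in> multi_indices Js" "is' \<in> multi_indices Is" "length Js = length Is"
  shows "splice js is' \<in> multi_indices (splice Js Is)"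
  using assms(3,1,2)
proof (induction Js Is arbitrary: js is' rule: list_induct2)
  case (Cons J Js I Is)
  then show ?case
    by (cases js; cases is') (auto simp: Cons_in_multi_indices_iff dest: length_multi_indices)
qed auto

lemma append_in_multi_indices:
  assumes "js \<in> multi_indices Js" "is' \<in> multi_indices Is"
  shows "js @ is' \<in> multi_indices (Js @ Is)"
  using assms by (auto simp: multi_indices_def nth_append)

text \<open>Division with remainder in each mode: the quotients locate the block, the remainders the
  position inside it. This later reindexes the columns of the reachability tensor.\<close>

lemma bij_betw_div_mod_indices:
  assumes "length Js = length Ks"
  shows "bij_betw (\<lambda>ls. (map2 (div) ls Ks, map2 (mod) ls Ks))
     (multi_indices (map2 (*) Js Ks)) (multi_indices Js \<times> multi_indices Ks)"
proof (rule bij_betw_byWitness[where f' = "\<lambda>(ps, ks). map2 (+) ks (map2 (*) ps Ks)"])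
  show "\<forall>ls\<in>multi_indices (map2 (*) Js Ks).
      (case (map2 (div) ls Ks, map2 (mod) ls Ks) of (ps, ks) \<Rightarrow> map2 (+) ks (map2 (*) ps Ks)) = ls"
    using assms by (auto simp: multi_indices_def mod_div_mult_eq intro!: nth_equalityI)
  show "\<forall>pk\<in>multi_indices Js \<times> multi_indices Ks.
      (\<lambda>ls. (map2 (div) ls Ks, map2 (mod) ls Ks))
        (case pk of (ps, ks) \<Rightarrow> map2 (+) ks (map2 (*) ps Ks)) = pk"
    using assms by (auto simp: multi_indices_def intro!: nth_equalityI)
  \<comment> \<open>The remainder bound needs a positive \<open>K\<close> in each mode; this holds
    because an index below \<open>J * K\<close> exists there.\<close>
  show "(\<lambda>ls. (map2 (div) ls Ks, map2 (mod) ls Ks)) ` multi_indices (map2 (*) Js Ks)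
      \<subseteq> multi_indices Js \<times> multi_indices Ks"
    using assms
    by (auto simp: multi_indices_def less_mult_imp_div_less intro!: mod_less_divisor)
       (metis gr0I less_nat_zero_code mult_0_right)
  show "(\<lambda>(ps, ks). map2 (+) ks (map2 (*) ps Ks)) ` (multi_indices Js \<times> multi_indices Ks)
      \<subseteq> multi_indices (map2 (*) Js Ks)"
  proof -
    have "k + p * K < J * K" if "k < K" "p < J" for k p J K :: nat
    proof -
      have "k + p * K < Suc p * K" using that by simp
      also have "\<dots> \<le> J * K" using that by (intro mult_le_mono1) simp
      finally show ?thesis .
    qed
    then show ?thesis using assms by (auto simp: multi_indices_def)
  qed
qed


section \<open>Einstein products entry by entry\<close>

lemma einstein_prod_splice:
  assumes "js \<in> multi_indices Js" "is' \<in> multi_indices Is" "length Js = length Is"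
  shows "einstein_prod Js Ks Is A B (splice js is') =
    (\<Sum>ks \<in> multi_indices Ks. A (splice js ks) * B (splice ks is'))"
  using assms splice_in_multi_indices[OF assms]
  by (simp add: einstein_prod_def modes_splice length_multi_indices)

lemma einstein_prod_id_splice:
  assumes "js \<in> multi_indices Js" "ks \<in> multi_indices Ks" "length Js = length Ks"
  shows "einstein_prod Js Js Ks (einstein_id Js) B (splice js ks) = B (splice js ks)"
proof -
  have "einstein_id Js (splice js is') = (if js = is' then 1 else 0)"
    if "is' \<in> multi_indices Js" for is'
    using splice_in_multi_indices[OF assms(1) that] assms(1) that
    by (simp add: einstein_id_def modes_splice length_multi_indices)
  then show ?thesis
    using assms finite_multi_indices[of Js]
    by (simp add: einstein_prod_splice if_distrib[of "\<lambda>x. x * _"] cong: if_cong sum.cong)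
qed

text \<open>Associativity of the Einstein product. It turns the blocks \<open>A^p * B\<close> into a
  sequence driven by \<open>A\<close>, as both the trajectory formula and the span argument
  require.\<close>

lemma einstein_prod_pow_Suc_splice:
  assumes "js \<in> multi_indices Js" "ks \<in> multi_indices Ks" "length Js = length Ks"
  shows "einstein_prod Js Js Ks (einstein_pow Js A (Suc p)) B (splice js ks) =
    (\<Sum>is' \<in> multi_indices Js.
      A (splice js is') * einstein_prod Js Js Ks (einstein_pow Js A p) B (splice is' ks))"
proof -
  let ?I = "multi_indices Js" and ?P = "einstein_pow Js A p"
  have "einstein_prod Js Js Ks (einstein_pow Js A (Suc p)) B (splice js ks) =
      (\<Sum>l\<in>?I. \<Sum>i\<in>?I. A (splice js i) * (?P (splice i l) * B (splice l ks)))"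
    using assms by (simp add: einstein_prod_splice sum_distrib_right mult.assoc)
  also have "\<dots> = (\<Sum>i\<in>?I. A (splice js i) * (\<Sum>l\<in>?I. ?P (splice i l) * B (splice l ks)))"
    by (subst sum.swap) (simp add: sum_distrib_left)
  finally show ?thesis using assms by (simp add: einstein_prod_splice)
qed

section \<open>Trajectories and reachability on an interval\<close>

text \<open>Discrete variation of constants, with time starting at 0. The input of time
  \<open>s\<close> is multiplied by \<open>A\<close> in each of the \<open>t - 1 - s\<close> later
  steps, hence the index \<open>t - Suc p\<close> beside the power \<open>p\<close>.\<close>

lemma trajectory_eq:
  assumes len: "length Js = length Ks"
    and step: "\<And>s. s < t \<Longrightarrow> x (Suc s) =
      tensor_add Js (einstein_apply Js Js A (x s)) (einstein_apply Js Ks B (u s))"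
    and "js \<in> multi_indices Js"
  shows "x t js = (einstein_apply Js Js A ^^ t) (x 0) js +
    (\<Sum>p<t. \<Sum>ks \<in> multi_indices Ks.
       einstein_prod Js Js Ks (einstein_pow Js A p) B (splice js ks) * u (t - Suc p) ks)"
  using step \<open>js \<in> multi_indices Js\<close>
proof (induction t arbitrary: js)
  case (Suc t)
  let ?I = "multi_indices Js" and ?K = "multi_indices Ks"
  let ?w = "\<lambda>t. (einstein_apply Js Js A ^^ t) (x 0)"
  let ?C = "\<lambda>p. einstein_prod Js Js Ks (einstein_pow Js A p) B"
  have IH: "x t i = ?w t i + (\<Sum>p<t. \<Sum>k\<in>?K. ?C p (splice i k) * u (t - Suc p) k)"
    if "i \<in> ?I" for i
    using Suc.IH Suc.prems(1) that by simp
  have "x (Suc t) js =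
      (\<Sum>i\<in>?I. A (splice js i) * x t i) + (\<Sum>k\<in>?K. B (splice js k) * u t k)"
    using Suc.prems by (simp add: tensor_add_def einstein_apply_def)
  also have "(\<Sum>i\<in>?I. A (splice js i) * x t i) = ?w (Suc t) js +
      (\<Sum>i\<in>?I. \<Sum>p<t. \<Sum>k\<in>?K. A (splice js i) * ?C p (splice i k) * u (t - Suc p) k)"
    using Suc.prems(2)
    by (simp add: IH einstein_apply_def distrib_left sum.distrib sum_distrib_left mult.assoc)
  \<comment> \<open>The sum over \<open>i\<close> is moved innermost, where it contracts
    \<open>A\<close> with block \<open>p\<close> into block \<open>Suc p\<close>.\<close>
  also have "(\<Sum>i\<in>?I. \<Sum>p<t. \<Sum>k\<in>?K. A (splice js i) * ?C p (splice i k) * u (t - Suc p) k) =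
      (\<Sum>p<t. \<Sum>i\<in>?I. \<Sum>k\<in>?K. A (splice js i) * ?C p (splice i k) * u (t - Suc p) k)"
    by (rule sum.swap)
  also have "\<dots> = (\<Sum>p<t. \<Sum>k\<in>?K. \<Sum>i\<in>?I. A (splice js i) * ?C p (splice i k) * u (t - Suc p) k)"
    by (intro sum.cong refl sum.swap)
  also have "\<dots> = (\<Sum>p<t. \<Sum>k\<in>?K. ?C (Suc p) (splice js k) * u (t - Suc p) k)"
    using Suc.prems(2) len
    by (simp add: einstein_prod_pow_Suc_splice sum_distrib_right del: einstein_pow.simps)
  also have "(\<Sum>k\<in>?K. B (splice js k) * u t k) = (\<Sum>k\<in>?K. ?C 0 (splice js k) * u t k)"
    using Suc.prems(2) len by (simp add: einstein_prod_id_splice)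
  finally show ?case
    \<comment> \<open>The newest input \<open>u t\<close> supplies the summand \<open>p = 0\<close>;
      the shifted blocks supply the rest.\<close>
    by (simp add: sum.lessThan_Suc_shift del: sum.lessThan_Suc einstein_pow.simps funpow.simps)
qed simp

text \<open>The free response is a fixed offset, so steering between arbitrary states amounts to
  reaching every state from zero. Only entries at multi-indices matter, so \<open>y\<close> and
  \<open>u\<close> may range over all functions.\<close>

lemma reachable_on_iff:
  assumes len: "length Js = length Ks" and "t0 < t1"
  shows "reachable_on Js Ks A B t0 t1 \<longleftrightarrow>
    (\<forall>y :: tensor. \<exists>u :: nat \<Rightarrow> tensor. \<forall>js \<in> multi_indices Js. y js =
      (\<Sum>p < nat (t1 - t0). \<Sum>ks \<in> multi_indices Ks.
         einstein_prod Js Js Ks (einstein_pow Js A p) B (splice js ks) * u p ks))"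
    (is "_ \<longleftrightarrow> ?surj")
proof
  let ?T = "nat (t1 - t0)"
  assume r: "reachable_on Js Ks A B t0 t1"
  show ?surj
  proof
    fix y :: tensor
    \<comment> \<open>Starting from the zero state makes the free response vanish.\<close>
    define z :: tensor where "z = (\<lambda>js \<in> multi_indices Js. 0)"
    have "z \<in> tensors Js" "restrict y (multi_indices Js) \<in> tensors Js"
      by (auto simp: z_def tensors_def)
    from r[unfolded reachable_on_def, THEN bspec, THEN bspec, OF this]
    obtain U X where
      step: "\<forall>t \<in> {t0..t1 - 1}. X (t + 1) =
        tensor_add Js (einstein_apply Js Js A (X t)) (einstein_apply Js Ks B (U t))"
      and X: "X t0 = z" "X t1 = restrict y (multi_indices Js)"
      by (elim exE conjE) (rule that)
    have z: "(einstein_apply Js Js A ^^ t) z = z" for t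
    proof (induction t)
      case (Suc t)
      have "einstein_apply Js Js A z = z"
        unfolding einstein_apply_def z_def by (rule restrict_ext) simp
      with Suc show ?case by simp
    qed simp
    have "y js = (\<Sum>p < ?T. \<Sum>ks \<in> multi_indices Ks.
        einstein_prod Js Js Ks (einstein_pow Js A p) B (splice js ks) * U (t0 + int (?T - Suc p)) ks)"
      if js: "js \<in> multi_indices Js" for js
    proof -
      have "X (t0 + int (Suc s)) = tensor_add Js (einstein_apply Js Js A (X (t0 + int s)))
          (einstein_apply Js Ks B (U (t0 + int s)))" if "s < ?T" for s
        using step[THEN bspec, of "t0 + int s"] that by (simp add: ac_simps)
      from trajectory_eq[where x = "\<lambda>s. X (t0 + int s)" and u = "\<lambda>s. U (t0 + int s)"
          and t = ?T, OF len this js]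
      have "X t1 js = (einstein_apply Js Js A ^^ ?T) (X t0) js + (\<Sum>p < ?T. \<Sum>ks \<in> multi_indices Ks.
          einstein_prod Js Js Ks (einstein_pow Js A p) B (splice js ks) * U (t0 + int (?T - Suc p)) ks)"
        using \<open>t0 < t1\<close> by simp
      then show ?thesis using js by (simp add: X z) (simp add: z_def)
    qed
    then show "\<exists>u :: nat \<Rightarrow> tensor. \<forall>js \<in> multi_indices Js. y js =
      (\<Sum>p < ?T. \<Sum>ks \<in> multi_indices Ks.
         einstein_prod Js Js Ks (einstein_pow Js A p) B (splice js ks) * u p ks)"
      by (intro exI[of _ "\<lambda>p. U (t0 + int (?T - Suc p))"] ballI)
  qed
next
  let ?T = "nat (t1 - t0)"
  assume surj: ?surj
  show "reachable_on Js Ks A B t0 t1"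
    unfolding reachable_on_def
  proof (intro ballI)
    fix X0 X1 assume X01: "X0 \<in> tensors Js" "X1 \<in> tensors Js"
    \<comment> \<open>The inputs only have to produce what the free response leaves short of
      \<open>X1\<close>.\<close>
    from surj[THEN spec, of "\<lambda>js. X1 js - (einstein_apply Js Js A ^^ ?T) X0 js"]
    obtain u :: "nat \<Rightarrow> tensor" where u: "\<forall>js \<in> multi_indices Js.
        X1 js - (einstein_apply Js Js A ^^ ?T) X0 js = (\<Sum>p < ?T. \<Sum>ks \<in> multi_indices Ks.
         einstein_prod Js Js Ks (einstein_pow Js A p) B (splice js ks) * u p ks)" ..
    \<comment> \<open>Time is reversed, since \<open>u p\<close> is paired with the power
      \<open>p\<close> and must act at time \<open>?T - Suc p\<close>; the restriction makes the
      inputs extensional.\<close>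
    define v where "v s = restrict (u (?T - Suc s)) (multi_indices Ks)" for s
    define x where "x = rec_nat X0 (\<lambda>s xs. tensor_add Js (einstein_apply Js Js A xs)
      (einstein_apply Js Ks B (v s)))"
    have x: "x 0 = X0" "x (Suc s) = tensor_add Js (einstein_apply Js Js A (x s))
        (einstein_apply Js Ks B (v s))" for s
      by (simp_all add: x_def)
    have xT: "x s \<in> tensors Js" for s
      by (cases s) (use X01 in \<open>auto simp: x tensor_add_def tensors_def\<close>)
    have "x ?T js = X1 js" if js: "js \<in> multi_indices Js" for js
    proof -
      have "v (?T - Suc p) ks = u p ks" if "p < ?T" "ks \<in> multi_indices Ks" for p ks
        using that by (simp add: v_def Suc_diff_Suc)
      with trajectory_eq[where x = x and u = v and A = A and B = B and t = ?T, OF len x(2) js]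
        u[THEN bspec, OF js]
      show ?thesis by (simp add: x(1))
    qed
    then have x1: "x ?T = X1"
      using xT[of ?T] X01(2) unfolding tensors_def by (intro PiE_ext)
    show "\<exists>U X. (\<forall>t \<in> {t0..t1 - 1}. U t \<in> tensors Ks) \<and> (\<forall>t \<in> {t0..t1}. X t \<in> tensors Js) \<and>
        (\<forall>t \<in> {t0..t1 - 1}. X (t + 1) =
          tensor_add Js (einstein_apply Js Js A (X t)) (einstein_apply Js Ks B (U t))) \<and>
        X t0 = X0 \<and> X t1 = X1"
    proof (rule exI[of _ "\<lambda>t. v (nat (t - t0))"], rule exI[of _ "\<lambda>t. x (nat (t - t0))"],
        intro conjI ballI)
      fix t assume "t \<in> {t0..t1 - 1}"
      then have "nat (t + 1 - t0) = Suc (nat (t - t0))" by auto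
      then show "x (nat (t + 1 - t0)) = tensor_add Js (einstein_apply Js Js A (x (nat (t - t0))))
          (einstein_apply Js Ks B (v (nat (t - t0))))"
        by (simp add: x)
    qed (auto simp: x x1 xT, auto simp: v_def tensors_def)
  qed
qed

section \<open>Bounding the horizon\<close>

text \<open>For each fixed \<open>k\<close> the columns of \<open>C m\<close> follow the recurrence
  given by \<open>a\<close>, so all of them lie in the span of the first \<open>card I\<close>. This
  covers \<open>T\<close> on either side of \<open>card I\<close> at once.\<close>

lemma surj_finite_horizon:
  fixes C :: "nat \<Rightarrow> 'i \<Rightarrow> 'k \<Rightarrow> 'a :: field"
  assumes fin: "finite I"
    and step: "\<And>m j k. j \<in> I \<Longrightarrow> k \<in> K \<Longrightarrow> C (Suc m) j k = (\<Sum>i\<in>I. a j i * C m i k)"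
    and surj: "\<forall>y. \<exists>u. \<forall>j\<in>I. y j = (\<Sum>p<T. \<Sum>k\<in>K. C p j k * u p k)"
  shows "\<forall>y. \<exists>u. \<forall>j\<in>I. y j = (\<Sum>p<card I. \<Sum>k\<in>K. C p j k * u p k)"
proof
  fix y
  obtain u where u: "\<And>j. j \<in> I \<Longrightarrow> y j = (\<Sum>p<T. \<Sum>k\<in>K. C p j k * u p k)"
    using surj by metis
  \<comment> \<open>The coefficients may depend on the column \<open>k\<close>, unlike the uniform
    ones that Cayley-Hamilton would give.\<close>
  have "\<forall>m. \<forall>k\<in>K. \<exists>c. \<forall>j\<in>I. C m j k = (\<Sum>i<card I. c i * C i j k)"
    using linear_recurrence_span[OF fin, of "\<lambda>m j. C m j _" a] step by blast
  then obtain c where c: "\<And>m k j. k \<in> K \<Longrightarrow> j \<in> I \<Longrightarrow> C m j k = (\<Sum>i<card I. c m k i * C i j k)"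
    by metis
  \<comment> \<open>Substituting these combinations and collecting the factor of
    \<open>C i j k\<close> yields the new inputs.\<close>
  have "y j = (\<Sum>i<card I. \<Sum>k\<in>K. C i j k * (\<Sum>p<T. c p k i * u p k))" if "j \<in> I" for j
  proof -
    have "y j = (\<Sum>p<T. \<Sum>k\<in>K. (\<Sum>i<card I. c p k i * C i j k) * u p k)"
      unfolding u[OF that] by (intro sum.cong refl arg_cong2[of _ _ _ _ "(*)"] c that)
    also have "\<dots> = (\<Sum>p<T. \<Sum>k\<in>K. \<Sum>i<card I. C i j k * (c p k i * u p k))"
      by (simp add: sum_distrib_left sum_distrib_right ac_simps)
    also have "\<dots> = (\<Sum>p<T. \<Sum>i<card I. \<Sum>k\<in>K. C i j k * (c p k i * u p k))"
      by (intro sum.cong refl sum.swap)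
    also have "\<dots> = (\<Sum>i<card I. \<Sum>p<T. \<Sum>k\<in>K. C i j k * (c p k i * u p k))"
      by (rule sum.swap)
    also have "\<dots> = (\<Sum>i<card I. \<Sum>k\<in>K. \<Sum>p<T. C i j k * (c p k i * u p k))"
      by (intro sum.cong refl sum.swap)
    finally show ?thesis by (simp add: sum_distrib_left)
  qed
  then show "\<exists>u. \<forall>j\<in>I. y j = (\<Sum>p<card I. \<Sum>k\<in>K. C p j k * u p k)"
    by (intro exI[of _ "\<lambda>i k. \<Sum>p<T. c p k i * u p k"] ballI)
qed

section \<open>The reachability tensor and its unfolding\<close>

lemma reachability_tensor_splice:
  assumes js: "js \<in> multi_indices Js" and ls: "ls \<in> multi_indices (map2 (*) Js Ks)"
    and len: "length Js = length Ks"
  shows "reachability_tensor Js Ks A B (splice js ls) =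
    einstein_prod Js Js Ks (einstein_pow Js A (lin_index Js (map2 (div) ls Ks))) B
      (splice js (map2 (mod) ls Ks))"
proof -
  \<comment> \<open>\<open>mode_row_block\<close> writes the extents as \<open>K * P\<close>, the
    index set here as \<open>J * K\<close>.\<close>
  have comm: "map2 (*) Ks Js = map2 (*) Js Ks"
    using len by (intro nth_equalityI) (simp_all add: mult.commute)
  have l: "length js = length ls" using js ls len by (simp add: length_multi_indices)
  \<comment> \<open>The block number has to stay within the list of blocks for the lookup by
    \<open>!\<close> to be meaningful.\<close>
  have "map2 (div) ls Ks \<in> multi_indices Js"
    using bij_betw_apply[OF bij_betw_div_mod_indices[OF len] ls] by simp
  then have "lin_index Js (map2 (div) ls Ks) < prod_list Js"
    using bij_betw_apply[OF bij_betw_lin_index] by blast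
  then show ?thesis
    using splice_in_multi_indices[OF js ls] len l
    by (simp add: reachability_tensor_def mode_row_block_def comm modes_splice)
qed

text \<open>Up to reindexing, multiplying the unfolding by a vector is the double sum over powers
  and input indices, so full row rank is surjectivity of that sum.\<close>

lemma optimal_tt_rank_reachability_iff:
  assumes len: "length Js = length Ks"
  shows "optimal_tt_rank (Js @ map2 (*) Js Ks) (length Js)
      (unpair_modes Js (map2 (*) Js Ks) (reachability_tensor Js Ks A B)) = prod_list Js \<longleftrightarrow>
    (\<forall>y :: tensor. \<exists>u :: nat \<Rightarrow> tensor. \<forall>js \<in> multi_indices Js. y js =
      (\<Sum>p < prod_list Js. \<Sum>ks \<in> multi_indices Ks.
         einstein_prod Js Js Ks (einstein_pow Js A p) B (splice js ks) * u p ks))"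
proof -
  define n where "n = prod_list Js"
  define Ls where "Ls = map2 (*) Js Ks"
  define nc where "nc = prod_list Ls"
  define M where "M = unfolding_mat (Js @ Ls) (length Js)
    (unpair_modes Js Ls (reachability_tensor Js Ks A B))"
  let ?C = "\<lambda>p. einstein_prod Js Js Ks (einstein_pow Js A p) B"
  let ?I = "multi_indices Js" and ?K = "multi_indices Ks"
  have M: "M \<in> carrier_mat n nc" by (simp add: M_def unfolding_mat_def n_def nc_def)
  \<comment> \<open>A column number is decoded into a power \<open>p\<close> and an input index
    \<open>ks\<close>; this is a bijection because linearisation and the split into quotients and
    remainders are.\<close>
  define col where "col = (\<lambda>c. (lin_index Js (map2 (div) (multi_index Ls c) Ks),
    map2 (mod) (multi_index Ls c) Ks))"
  have "bij_betw (map_prod (lin_index Js) id \<circ> ((\<lambda>ls. (map2 (div) ls Ks, map2 (mod) ls Ks)) \<circ>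
      multi_index Ls)) {..<nc} ({..<n} \<times> ?K)"
    unfolding n_def nc_def
    by (rule bij_betw_trans[OF bij_betw_trans[OF bij_betw_multi_index
            bij_betw_div_mod_indices[OF len, folded Ls_def]]
          bij_betw_map_prod[OF bij_betw_lin_index bij_betw_id]])
  then have col: "bij_betw col {..<nc} ({..<n} \<times> ?K)"
    by (simp add: col_def comp_def map_prod_def)
  have entry: "M $$ (r, c) = (case col c of (p, ks) \<Rightarrow> ?C p (splice (multi_index Js r) ks))"
    if "r < n" "c < nc" for r c
  proof -
    have mi: "multi_index Js r \<in> ?I" "multi_index Ls c \<in> multi_indices Ls"
      using bij_betw_multi_index[of Js] bij_betw_multi_index[of Ls] that
      by (auto simp: bij_betw_def n_def nc_def)
    have "M $$ (r, c) = reachability_tensor Js Ks A B (splice (multi_index Js r) (multi_index Ls c))"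
      using that append_in_multi_indices[OF mi] length_multi_indices[OF mi(1)]
      by (simp add: M_def unfolding_mat_def unpair_modes_def n_def nc_def)
    then show ?thesis
      using reachability_tensor_splice[OF mi[unfolded Ls_def] len]
      by (simp add: col_def Ls_def)
  qed
  \<comment> \<open>Here \<open>x\<close> is the input sequence \<open>u\<close> flattened along
    \<open>col\<close>.\<close>
  have mult: "(M *\<^sub>v x) $ r = (\<Sum>p<n. \<Sum>ks\<in>?K. ?C p (splice (multi_index Js r) ks) * u p ks)"
    if "r < n" "x \<in> carrier_vec nc" and u: "\<And>c. c < nc \<Longrightarrow> x $ c = (case col c of (p, ks) \<Rightarrow> u p ks)"
    for r x u
  proof -
    have "(M *\<^sub>v x) $ r = (\<Sum>c<nc. M $$ (r, c) * x $ c)"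
      using M that(1,2) by (auto simp: scalar_prod_def atLeast0LessThan)
    also have "\<dots> = (\<Sum>c<nc. case col c of (p, ks) \<Rightarrow> ?C p (splice (multi_index Js r) ks) * u p ks)"
      using that by (simp add: entry case_prod_beta)
    also have "\<dots> = (\<Sum>(p, ks) \<in> {..<n} \<times> ?K. ?C p (splice (multi_index Js r) ks) * u p ks)"
      by (rule sum.reindex_bij_betw[OF col])
    finally show ?thesis by (simp add: sum.cartesian_product)
  qed
  have rc: "js = multi_index Js (lin_index Js js)" "lin_index Js js < n" if "js \<in> ?I" for js
    using that bij_betw_lin_index[of Js]
    by (auto simp: multi_index_def n_def bij_betw_def the_inv_into_f_f)
  have cr: "lin_index Js (multi_index Js r) = r" "multi_index Js r \<in> ?I" if "r < n" for r
    using that bij_betw_lin_index[of Js] bij_betw_multi_index[of Js]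
    by (auto simp: multi_index_def n_def bij_betw_def f_the_inv_into_f)
  have "(\<forall>y \<in> carrier_vec n. \<exists>x \<in> carrier_vec nc. M *\<^sub>v x = y) \<longleftrightarrow>
    (\<forall>y :: tensor. \<exists>u :: nat \<Rightarrow> tensor. \<forall>js \<in> ?I. y js =
      (\<Sum>p < n. \<Sum>ks \<in> ?K. ?C p (splice js ks) * u p ks))" (is "?vec \<longleftrightarrow> ?ten")
  proof
    assume vec: ?vec
    show ?ten
    proof
      fix y :: tensor
      obtain x where x: "x \<in> carrier_vec nc" "M *\<^sub>v x = vec n (\<lambda>r. y (multi_index Js r))"
        using vec by (metis vec_carrier)
      \<comment> \<open>Unflattening along the inverse of \<open>col\<close>.\<close>
      define u where "u p ks = x $ (inv_into {..<nc} col (p, ks))" for p ks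
      have "x $ c = (case col c of (p, ks) \<Rightarrow> u p ks)" if "c < nc" for c
        using col that by (auto simp: u_def bij_betw_def inv_into_f_f split: prod.split)
      note m = mult[OF _ x(1) this]
      have "y js = (\<Sum>p < n. \<Sum>ks \<in> ?K. ?C p (splice js ks) * u p ks)" if "js \<in> ?I" for js
        using m[OF rc(2)[OF that]] rc[OF that] x(2) by simp
      then show "\<exists>u :: nat \<Rightarrow> tensor. \<forall>js \<in> ?I. y js =
          (\<Sum>p < n. \<Sum>ks \<in> ?K. ?C p (splice js ks) * u p ks)"
        by (intro exI[of _ u] ballI)
    qed
  next
    assume ten: ?ten
    show ?vec
    proof
      fix y :: "real vec" assume y: "y \<in> carrier_vec n"
      from ten[THEN spec, of "\<lambda>js. y $ lin_index Js js"]
      obtain u :: "nat \<Rightarrow> tensor" where u: "\<forall>js \<in> ?I. y $ lin_index Js js =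
          (\<Sum>p < n. \<Sum>ks \<in> ?K. ?C p (splice js ks) * u p ks)" ..
      define x where "x = vec nc (\<lambda>c. case col c of (p, ks) \<Rightarrow> u p ks)"
      have "M *\<^sub>v x = y"
      proof (rule eq_vecI)
        fix r assume "r < dim_vec y"
        then have r: "r < n" using y by simp
        have "(M *\<^sub>v x) $ r = (\<Sum>p<n. \<Sum>ks\<in>?K. ?C p (splice (multi_index Js r) ks) * u p ks)"
          by (rule mult[OF r]) (simp_all add: x_def)
        then show "(M *\<^sub>v x) $ r = y $ r" using u[THEN bspec, OF cr(2)[OF r]] cr(1)[OF r] by simp
      qed (use M y in simp)
      then show "\<exists>x \<in> carrier_vec nc. M *\<^sub>v x = y" by (auto simp: x_def)
    qed
  qed
  moreover have "optimal_tt_rank (Js @ Ls) (length Js)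
      (unpair_modes Js Ls (reachability_tensor Js Ks A B)) = vec_space.rank n M"
    using M by (simp add: optimal_tt_rank_def M_def[symmetric])
  ultimately show ?thesis
    using vec_space.rank_eq_n_iff_surj[OF M] by (simp add: n_def Ls_def)
qed

section \<open>Joining the bounded horizon with the rank criterion\<close>

theorem corollary5p12:
  fixes N :: nat and Js Ks :: "nat list" and A B :: tensor
  assumes "N \<ge> 1"
    and "length Js = N" and "\<forall>J \<in> set Js. J \<ge> 1"
    and "length Ks = N" and "\<forall>K \<in> set Ks. K \<ge> 1"
    and "A \<in> tensors (splice Js Js)"
    and "B \<in> tensors (splice Js Ks)"
  shows "reachable Js Ks A B \<longleftrightarrow>
    optimal_tt_rank (Js @ map2 (*) Js Ks) N
      (unpair_modes Js (map2 (*) Js Ks) (reachability_tensor Js Ks A B)) = prod_list Js"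
proof -
  have len: "length Js = length Ks" using assms by simp
  let ?surj = "\<lambda>T. \<forall>y :: tensor. \<exists>u :: nat \<Rightarrow> tensor. \<forall>js \<in> multi_indices Js. y js =
      (\<Sum>p < T. \<Sum>ks \<in> multi_indices Ks.
         einstein_prod Js Js Ks (einstein_pow Js A p) B (splice js ks) * u p ks)"
  \<comment> \<open>Reachability asks for \<open>t0 < t1\<close>, so the horizon
    \<open>prod_list Js\<close> must be at least 1.\<close>
  have pos: "prod_list Js > 0" using assms(3) by (auto intro!: gr0I)
  have "reachable Js Ks A B \<longleftrightarrow> ?surj (prod_list Js)"
  proof
    assume "reachable Js Ks A B"
    then obtain t0 t1 where "t0 < t1" "reachable_on Js Ks A B t0 t1"
      by (auto simp: reachable_def)
    then have surj: "?surj (nat (t1 - t0))" using reachable_on_iff[OF len] by simp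
    have "?surj (card (multi_indices Js))"
    proof (rule surj_finite_horizon[where I = "multi_indices Js" and K = "multi_indices Ks" and
          C = "\<lambda>p js ks. einstein_prod Js Js Ks (einstein_pow Js A p) B (splice js ks)" and
          a = "\<lambda>js is'. A (splice js is')", OF finite_multi_indices _ surj])
    qed (rule einstein_prod_pow_Suc_splice[OF _ _ len])
    then show "?surj (prod_list Js)" unfolding card_multi_indices .
  next
    assume "?surj (prod_list Js)"
    then have "reachable_on Js Ks A B 0 (int (prod_list Js))"
      using pos by (subst reachable_on_iff[OF len]) simp_all
    then show "reachable Js Ks A B"
      using pos unfolding reachable_def by (intro exI[of _ 0] exI[of _ "int (prod_list Js)"]) simp
  qed
  then show ?thesis
    using optimal_tt_rank_reachability_iff[OF len] assms(2) by simp
qed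

end
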